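(* Let $X\ge 0$ be a random variable with distribution $F$ and let ${\bf E}[X^s]\in(0,\infty)$ for some $s\in(0,1)$. Let $\{a_k\}_{k=1}^{\infty}$ be a sequence of positive and distinct real numbers satisfying one of the following conditions: (a) $\lim_{k\to\infty}a_k=\infty$ and $\sum_{k=1}^{\infty}1/a_k=\infty$; (b) $\lim_{k\to\infty}a_k=a_0\in(0,\infty)$; (c) $\lim_{k\to\infty}a_k=0$ and $\sum_{k=1}^{\infty}a_k=\infty$. Then the distribution $F$ is completely determined by the sequence of translated fractional moments $$M_s^+=\{{\bf E}[X^s]\}\cup\{{\bf E}[(X+a_k)^s]\}_{k=1}^{\infty}.$$ That is, if $Y\ge 0$ is a random variable with distribution $G$ such that ${\bf E}[Y^s]={\bf E}[X^s]$ and ${\bf E}[(Y+a_k)^s]={\bf E}[(X+a_k)^s]$ for all $k\ge 1$, then $G=F$.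
   Context: The distribution of a random variable $X$ is its distribution function $F(x)=\Pr(X\le x)$. "Completely determined" means determined among distributions of nonnegative random variables, with $s$ and the sequence $\{a_k\}$ given. *)

theory Defs
  imports "HOL-Probability.Probability"
begin

end

theory Submission
  imports Defs "HOL-Complex_Analysis.Conformal_Mappings"
begin

text \<open>
  For \<open>Re z > 0\<close> put \<open>\<phi> z = E[(Y + z)\<^sup>s] - E[(X + z)\<^sup>s]\<close>, with complex powers. This function is
  holomorphic on the right half-plane, since one may differentiate under the expectation. It is
  also bounded there: for \<open>x \<ge> 0\<close> the difference \<open>(x + z)\<^sup>s - z\<^sup>s\<close> is at most \<open>3 x\<^sup>s\<close> in modulus
  (\<open>norm_translated_powr_diff_le\<close>), and the terms \<open>z\<^sup>s\<close> cancel in \<open>\<phi>\<close>. The hypotheses say that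
  \<open>\<phi>\<close> vanishes at all points \<open>a k\<close>.

  A nonzero bounded holomorphic function on the half-plane with distinct positive zeros \<open>a k\<close>
  must satisfy the Blaschke condition that the sum of \<open>a k / (R + a k)\<^sup>2\<close> converges
  (\<open>bounded_holomorphic_halfplane_eq_0\<close>). In each of the three cases this sum diverges
  (\<open>Blaschke_sum_diverges\<close>), so \<open>\<phi>\<close> is identically 0.

  It remains to recover the distribution from the function \<open>z \<mapsto> E[(X + z)\<^sup>s]\<close>
  (\<open>translated_moments_determine_cdf\<close>). Its derivatives at \<open>z = 1\<close> are, up to nonzero factors, the
  expectations of \<open>V powr (1 - s) * V ^ m\<close> with \<open>V = 1 / (1 + X)\<close>, a random variable with values in
  \<open>{0..1}\<close>. By the Weierstrass approximation theorem they determine the expectation of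
  \<open>V powr (1 - s) * h V\<close> for every continuous \<open>h\<close>. Continuous approximations of the indicators of
  the events \<open>X \<le> x\<close> have this form, and they determine the distribution function.
\<close>

section \<open>Zeros of bounded holomorphic functions on the right half-plane\<close>

text \<open>
  The quotient \<open>f / (C + \<epsilon>)\<close> is strictly bounded by 1, so the classical Schwarz lemma applies to
  it; letting \<open>\<epsilon>\<close> tend to 0 gives the sharp constant, also when \<open>C = 0\<close>.
\<close>

lemma Schwarz_bounded:
  assumes holf: "f holomorphic_on ball 0 1" and f0: "f 0 = 0"
    and bound: "\<And>w. norm w < 1 \<Longrightarrow> norm (f w) \<le> C"
    and \<xi>: "norm \<xi> < 1"
  shows "norm (f \<xi>) \<le> C * norm \<xi>"
proof (rule field_le_epsilon)
  fix e :: real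
  assume e: "0 < e"
  have "0 \<le> C"
    using bound[of 0] f0 by simp
  then have Ce: "0 < C + e"
    using e by simp
  have "norm (f \<xi> / of_real (C + e)) \<le> norm \<xi>"
  proof (rule Schwarz_Lemma(1)[where f = "\<lambda>w. f w / of_real (C + e)"])
    show "(\<lambda>w. f w / complex_of_real (C + e)) holomorphic_on ball 0 1"
      using Ce by (intro holomorphic_intros holf) (simp flip: of_real_add)
    show "norm (f w / complex_of_real (C + e)) < 1" if "norm w < 1" for w
      using bound[OF that] Ce e by (simp add: norm_divide divide_simps del: of_real_add)
  qed (use f0 \<xi> in auto)
  then have "norm (f \<xi>) \<le> (C + e) * norm \<xi>"
    using Ce by (simp add: norm_divide divide_simps mult.commute del: of_real_add)
  also have "\<dots> \<le> C * norm \<xi> + e"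
    using \<xi> e by (simp add: distrib_right mult_left_le)
  finally show "norm (f \<xi>) \<le> C * norm \<xi> + e" .
qed

text \<open>
  The Cayley map \<open>w \<mapsto> a (1 + w) / (1 - w)\<close> carries the unit disc onto the right half-plane and
  0 to \<open>a\<close>, so this is the Schwarz lemma on the disc; the inverse map is
  \<open>z \<mapsto> (z - a) / (z + a)\<close>.
\<close>

lemma Schwarz_halfplane:
  assumes holf: "f holomorphic_on {z. 0 < Re z}"
    and bound: "\<And>z. 0 < Re z \<Longrightarrow> norm (f z) \<le> C"
    and a: "0 < a" and fa: "f (of_real a) = 0" and z: "0 < Re z"
  shows "norm (f z) \<le> C * (norm (z - of_real a) / norm (z + of_real a))"
proof -
  define c where "c w = of_real a * (1 + w) / (1 - w)" for w :: complex
  have c_re: "0 < Re (c w)" if w: "norm w < 1" for w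
  proof -
    have "w \<noteq> 1" using w by auto
    then have "(1 - Re w)\<^sup>2 + (Im w)\<^sup>2 > 0"
      by (auto simp: complex_eq_iff sum_power2_gt_zero_iff)
    moreover have "(Re w)\<^sup>2 + (Im w)\<^sup>2 < 1"
      using w by (simp add: cmod_def real_sqrt_less_iff)
    moreover have "Re (c w) = a * (1 - ((Re w)\<^sup>2 + (Im w)\<^sup>2)) / ((1 - Re w)\<^sup>2 + (Im w)\<^sup>2)"
      by (simp add: c_def Re_divide power2_eq_square algebra_simps)
    ultimately show ?thesis
      using a by simp
  qed
  define \<xi> where "\<xi> = (z - of_real a) / (z + of_real a)"
  have za: "z + of_real a \<noteq> 0"
    using z a by (auto simp: complex_eq_iff)
  have "norm (z - of_real a) < norm (z + of_real a)"
    using z a unfolding cmod_def real_sqrt_less_iff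
    by (simp add: power2_eq_square algebra_simps mult_pos_pos)
  then have \<xi>1: "norm \<xi> < 1"
    using za by (simp add: \<xi>_def norm_divide divide_simps)
  have "1 - \<xi> = 2 * of_real a / (z + of_real a)" "1 + \<xi> = 2 * z / (z + of_real a)"
    using za by (simp_all add: \<xi>_def field_simps)
  then have c\<xi>: "c \<xi> = z"
    using za a by (simp add: c_def)
  have "norm ((f \<circ> c) \<xi>) \<le> C * norm \<xi>"
  proof (rule Schwarz_bounded)
    show "f \<circ> c holomorphic_on ball 0 1"
    proof (rule holomorphic_on_compose_gen[OF _ holf])
      show "c holomorphic_on ball 0 1"
        unfolding c_def by (intro holomorphic_intros) auto
    qed (use c_re in auto)
  qed (use \<xi>1 bound c_re fa in \<open>auto simp: c_def\<close>)
  then show ?thesis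
    unfolding comp_def c\<xi> by (simp add: \<xi>_def norm_divide)
qed

text \<open>
  Dividing \<open>f\<close> by the factor \<open>(z - b) / (z + b)\<close> of one of its zeros leaves a function that is
  again holomorphic and, by the Schwarz lemma, again bounded by \<open>C\<close>. Since the factor vanishes
  only at \<open>b\<close>, the other zeros survive, so they can be divided out one at a time.
\<close>

lemma Blaschke_bound_halfplane:
  assumes "finite A" and "\<And>a. a \<in> A \<Longrightarrow> 0 < a \<and> f (of_real a) = 0"
    and "f holomorphic_on {z. 0 < Re z}" and "\<And>z. 0 < Re z \<Longrightarrow> norm (f z) \<le> C"
    and "0 < Re z"
  shows "norm (f z) \<le> C * (\<Prod>a\<in>A. norm (z - of_real a) / norm (z + of_real a))"
  using assms
proof (induction A arbitrary: f rule: finite_induct)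
  case empty
  then show ?case by simp
next
  case (insert b A)
  note holf = insert.prems(2) and bound = insert.prems(3)
  have b: "0 < b" and fb: "f (of_real b) = 0"
    using insert.prems(1) by auto
  have op: "open {z. 0 < Re z}"
    by (rule open_halfspace_Re_gt)
  define h where "h w = (if w = of_real b then deriv f (of_real b)
                         else (f w - f (of_real b)) / (w - of_real b))" for w
  define g where "g w = h w * (w + of_real b)" for w
  have holg: "g holomorphic_on {z. 0 < Re z}"
    unfolding g_def h_def by (intro holomorphic_intros pole_lemma_open[OF holf op])
  have f_eq: "f w = (w - of_real b) / (w + of_real b) * g w" if "0 < Re w" for w
  proof -
    have "w + of_real b \<noteq> 0"
      using that b by (auto simp: complex_eq_iff)
    then show ?thesis
      by (auto simp: g_def h_def fb)
  qed
  have g_off: "norm (g w) \<le> C" if w: "0 < Re w" "w \<noteq> of_real b" for w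
  proof -
    have "norm (w - of_real b) / norm (w + of_real b) > 0"
      using w b by (auto simp: complex_eq_iff)
    moreover have "norm (g w) * (norm (w - of_real b) / norm (w + of_real b))
        \<le> C * (norm (w - of_real b) / norm (w + of_real b))"
      using Schwarz_halfplane[OF holf bound b fb w(1)]
      by (simp add: f_eq[OF w(1)] norm_mult norm_divide mult.commute)
    ultimately show ?thesis
      by (metis mult_right_le_imp_le)
  qed
  \<comment> \<open>The bound extends to the removable singularity \<open>b\<close> by continuity.\<close>
  have g_bound: "norm (g w) \<le> C" if w: "0 < Re w" for w
  proof (cases "w = of_real b")
    case True
    have "isCont g w"
      using holomorphic_on_imp_continuous_on[OF holg] op w
      by (simp add: continuous_on_eq_continuous_at)
    then have "((\<lambda>u. norm (g u)) \<longlongrightarrow> norm (g w)) (at w)"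
      by (intro tendsto_norm) (simp add: isCont_def)
    moreover have "\<forall>\<^sub>F u in at w. norm (g u) \<le> C"
    proof -
      have "\<forall>\<^sub>F u in at w. u \<in> {z. 0 < Re z}"
        using eventually_at_in_open'[OF op] w by simp
      moreover have "\<forall>\<^sub>F u in at w. u \<noteq> w"
        by (rule eventually_neq_at_within)
      ultimately show ?thesis
        by eventually_elim (use True g_off in auto)
    qed
    ultimately show ?thesis
      by (rule tendsto_upperbound) simp
  qed (use g_off w in blast)
  have gA: "0 < a \<and> g (of_real a) = 0" if "a \<in> A" for a
  proof -
    have "a \<noteq> b" using that insert.hyps by auto
    moreover have "0 < a" "f (of_real a) = 0" using that insert.prems(1) by auto
    ultimately show ?thesis
      by (simp add: g_def h_def fb)
  qed
  have IH: "norm (g z) \<le> C * (\<Prod>a\<in>A. norm (z - of_real a) / norm (z + of_real a))"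
    by (rule insert.IH[OF gA holg g_bound insert.prems(4)])
  have "norm (f z) = norm (z - of_real b) / norm (z + of_real b) * norm (g z)"
    by (simp add: f_eq[OF insert.prems(4)] norm_mult norm_divide)
  also have "\<dots> \<le> norm (z - of_real b) / norm (z + of_real b) *
                    (C * (\<Prod>a\<in>A. norm (z - of_real a) / norm (z + of_real a)))"
    by (intro mult_left_mono IH) simp
  finally show ?case
    using insert.hyps by (simp add: mult_ac)
qed

text \<open>
  The identity behind the estimate is \<open>|z - a|\<^sup>2 = |z + a|\<^sup>2 - 4 a Re z\<close>. Combined with
  \<open>1 - t \<le> exp (- t)\<close> it turns divergence of the sum of \<open>a / (|z| + a)\<^sup>2\<close> into convergence
  of the Blaschke product to 0.
\<close>

lemma Blaschke_factor_le_exp: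
  assumes a: "0 < a" and z: "0 < Re z"
  shows "norm (z - of_real a) / norm (z + of_real a) \<le> exp (- (2 * Re z * (a / (norm z + a)\<^sup>2)))"
proof -
  define t where "t = norm (z - of_real a) / norm (z + of_real a)"
  have pos: "norm (z + of_real a) > 0"
    using z a by (auto simp: complex_eq_iff)
  have "norm (z + of_real a) \<le> norm z + a"
    using norm_triangle_ineq[of z "of_real a"] a by simp
  then have le: "(norm (z + of_real a))\<^sup>2 \<le> (norm z + a)\<^sup>2"
    by (intro power_mono) auto
  have "(norm (z - of_real a))\<^sup>2 = (norm (z + of_real a))\<^sup>2 - 4 * a * Re z"
    by (simp add: cmod_power2) (simp add: power2_eq_square algebra_simps)
  then have "t\<^sup>2 = 1 - 4 * a * Re z / (norm (z + of_real a))\<^sup>2"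
    using pos by (simp add: t_def power_divide diff_divide_distrib)
  also have "\<dots> \<le> 1 - 4 * a * Re z / (norm z + a)\<^sup>2"
    using le a z pos by (intro diff_left_mono divide_left_mono mult_pos_pos zero_less_power add_nonneg_pos) auto
  also have "\<dots> \<le> exp (- (4 * a * Re z / (norm z + a)\<^sup>2))"
    using exp_ge_add_one_self[of "- (4 * a * Re z / (norm z + a)\<^sup>2)"] by simp
  also have "\<dots> = (exp (- (2 * Re z * (a / (norm z + a)\<^sup>2))))\<^sup>2"
    by (simp add: power2_eq_square flip: exp_add)
  finally show ?thesis
    unfolding t_def by (rule power2_le_imp_le) simp
qed

text \<open>
  The Blaschke uniqueness theorem for real zeros: the condition on the sum says that the zeros
  are too dense, as measured from the boundary of the half-plane (including infinity), for a
  nonzero bounded holomorphic function.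
\<close>

lemma bounded_holomorphic_halfplane_eq_0:
  assumes holf: "f holomorphic_on {z. 0 < Re z}"
    and bound: "\<And>z. 0 < Re z \<Longrightarrow> norm (f z) \<le> C"
    and pos: "\<And>k. 1 \<le> k \<Longrightarrow> 0 < a k" and zero: "\<And>k. 1 \<le> k \<Longrightarrow> f (of_real (a k)) = 0"
    and inj: "inj_on a {1..}"
    and diverges: "\<And>R. 0 < R \<Longrightarrow> filterlim (\<lambda>n. \<Sum>k = 1..n. a k / (R + a k)\<^sup>2) at_top sequentially"
    and z: "0 < Re z"
  shows "f z = 0"
proof -
  define S where "S n = (\<Sum>k = 1..n. a k / (norm z + a k)\<^sup>2)" for n
  have C: "0 \<le> C"
    using bound[OF z] norm_ge_zero order_trans by blast
  have le: "norm (f z) \<le> C * exp (- (2 * Re z * S n))" for n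
  proof -
    have inj': "inj_on a {1..n}"
      by (rule inj_on_subset[OF inj]) auto
    have "norm (f z) \<le> C * (\<Prod>a\<in>a ` {1..n}. norm (z - of_real a) / norm (z + of_real a))"
      by (rule Blaschke_bound_halfplane[OF _ _ holf bound z]) (use pos zero in auto)
    also have "(\<Prod>a\<in>a ` {1..n}. norm (z - of_real a) / norm (z + of_real a))
        = (\<Prod>k=1..n. norm (z - of_real (a k)) / norm (z + of_real (a k)))"
      by (subst prod.reindex[OF inj']) simp
    also have "\<dots> \<le> (\<Prod>k=1..n. exp (- (2 * Re z * (a k / (norm z + a k)\<^sup>2))))"
      by (intro prod_mono conjI Blaschke_factor_le_exp) (use pos z in auto)
    also have "\<dots> = exp (- (2 * Re z * S n))"
      by (simp add: exp_sum[symmetric] S_def sum_distrib_left sum_negf)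
    finally show ?thesis
      using C by (simp add: mult_left_mono)
  qed
  have "norm z > 0"
    using z by auto
  then have "filterlim S at_top sequentially"
    unfolding S_def by (rule diverges)
  then have "filterlim (\<lambda>n. 2 * Re z * S n) at_top sequentially"
    using z by (intro filterlim_tendsto_pos_mult_at_top[OF tendsto_const]) auto
  then have "(\<lambda>n. exp (- (2 * Re z * S n))) \<longlonglongrightarrow> 0"
    by (intro filterlim_compose[OF exp_at_bot]) (simp add: filterlim_uminus_at_top)
  then have "(\<lambda>n. C * exp (- (2 * Re z * S n))) \<longlonglongrightarrow> 0"
    by (rule tendsto_mult_right_zero)
  then have "norm (f z) \<le> 0"
    by (rule tendsto_lowerbound) (use le in auto)
  then show ?thesis
    by simp
qed

lemma filterlim_sum_at_top_eventually_ge: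
  fixes f g :: "nat \<Rightarrow> real"
  assumes f: "filterlim (\<lambda>n. \<Sum>k = 1..n. f k) at_top sequentially"
    and c: "0 < c" and ev: "\<forall>\<^sub>F k in sequentially. c * f k \<le> g k"
  shows "filterlim (\<lambda>n. \<Sum>k = 1..n. g k) at_top sequentially"
proof -
  obtain K where K: "\<And>k. K \<le> k \<Longrightarrow> c * f k \<le> g k"
    using ev by (auto simp: eventually_sequentially)
  define D where "D = (\<Sum>k = 1..K. g k - c * f k)"
  have "D + c * (\<Sum>k = 1..n. f k) \<le> (\<Sum>k = 1..n. g k)" if n: "K \<le> n" for n
  proof -
    have "D \<le> (\<Sum>k = 1..n. g k - c * f k)"
      unfolding D_def by (rule sum_mono2) (use n K in auto)
    then show ?thesis
      by (simp add: sum_subtractf sum_distrib_left)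
  qed
  then have "\<forall>\<^sub>F n in sequentially. D + c * (\<Sum>k = 1..n. f k) \<le> (\<Sum>k = 1..n. g k)"
    by (auto simp: eventually_sequentially)
  moreover have "filterlim (\<lambda>n. D + c * (\<Sum>k = 1..n. f k)) at_top sequentially"
    by (intro filterlim_tendsto_add_at_top[OF tendsto_const]
          filterlim_tendsto_pos_mult_at_top[OF tendsto_const c f])
  ultimately show ?thesis
    by (rule filterlim_at_top_mono[rotated])
qed

text \<open>
  The summand is comparable to \<open>1 / a\<close> for large \<open>a\<close>, to \<open>a\<close> for small \<open>a\<close>, and is bounded
  away from 0 near a positive limit. Hence each of the three alternatives is a form of the one
  condition that the Blaschke theorem needs.
\<close>

lemma Blaschke_sum_diverges:
  fixes a :: "nat \<Rightarrow> real"
  assumes pos: "\<And>k. 1 \<le> k \<Longrightarrow> 0 < a k"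
    and cases: "(filterlim a at_top sequentially \<and>
            filterlim (\<lambda>n. \<Sum>k = 1..n. 1 / a k) at_top sequentially) \<or>
         (\<exists>a0 > 0. a \<longlonglongrightarrow> a0) \<or>
         (a \<longlonglongrightarrow> 0 \<and>
            filterlim (\<lambda>n. \<Sum>k = 1..n. a k) at_top sequentially)"
    and R: "0 < R"
  shows "filterlim (\<lambda>n. \<Sum>k = 1..n. a k / (R + a k)\<^sup>2) at_top sequentially"
  using cases
proof (elim disjE exE conjE)
  assume lim: "filterlim a at_top sequentially"
    and sum: "filterlim (\<lambda>n. \<Sum>k = 1..n. 1 / a k) at_top sequentially"
  have "\<forall>\<^sub>F k in sequentially. R \<le> a k"
    using lim by (simp add: filterlim_at_top)
  then have "\<forall>\<^sub>F k in sequentially. 1/4 * (1 / a k) \<le> a k / (R + a k)\<^sup>2"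
  proof eventually_elim
    case (elim k)
    have "(R + a k)\<^sup>2 \<le> (2 * a k)\<^sup>2"
      using elim R by (intro power_mono) auto
    then have "a k / (2 * a k)\<^sup>2 \<le> a k / (R + a k)\<^sup>2"
      using elim R by (intro divide_left_mono) auto
    then show ?case
      using elim R by (simp add: power2_eq_square)
  qed
  then show ?thesis
    by (rule filterlim_sum_at_top_eventually_ge[OF sum, rotated]) simp
next
  fix a0 :: real
  assume a0: "0 < a0" and lim: "a \<longlonglongrightarrow> a0"
  have "(\<lambda>k. a k / (R + a k)\<^sup>2) \<longlonglongrightarrow> a0 / (R + a0)\<^sup>2"
    using a0 R by (intro tendsto_intros lim) auto
  moreover have half: "a0 / (R + a0)\<^sup>2 / 2 < a0 / (R + a0)\<^sup>2" and half0: "0 < a0 / (R + a0)\<^sup>2 / 2"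
    using a0 R by (auto simp: field_simps)
  ultimately have "\<forall>\<^sub>F k in sequentially. a0 / (R + a0)\<^sup>2 / 2 < a k / (R + a k)\<^sup>2"
    by (intro order_tendstoD(1))
  then have "\<forall>\<^sub>F k in sequentially. a0 / (R + a0)\<^sup>2 / 2 * 1 \<le> a k / (R + a k)\<^sup>2"
    by eventually_elim simp
  moreover have "filterlim (\<lambda>n. \<Sum>k = 1..n. 1 :: real) at_top sequentially"
    by (simp add: filterlim_real_sequentially)
  ultimately show ?thesis
    by (rule filterlim_sum_at_top_eventually_ge[OF _ half0, where f = "\<lambda>_. 1", rotated])
next
  assume lim: "a \<longlonglongrightarrow> 0"
    and sum: "filterlim (\<lambda>n. \<Sum>k = 1..n. a k) at_top sequentially"
  have "\<forall>\<^sub>F k in sequentially. a k < R"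
    using lim R by (rule order_tendstoD(2))
  moreover have "\<forall>\<^sub>F k in sequentially. 0 < a k"
    using pos by (auto simp: eventually_sequentially)
  ultimately have "\<forall>\<^sub>F k in sequentially. 1 / (4 * R\<^sup>2) * a k \<le> a k / (R + a k)\<^sup>2"
  proof eventually_elim
    case (elim k)
    have "(R + a k)\<^sup>2 \<le> (2 * R)\<^sup>2"
      using elim R by (intro power_mono) auto
    then have "a k / (2 * R)\<^sup>2 \<le> a k / (R + a k)\<^sup>2"
      using elim R by (intro divide_left_mono) auto
    then show ?case
      by (simp add: power2_eq_square)
  qed
  then show ?thesis
    by (rule filterlim_sum_at_top_eventually_ge[OF sum, rotated]) (use R in simp)
qed

section \<open>Holomorphy and boundedness of translated moments\<close>

text \<open>
  On a convex set the bound on the derivative also bounds all difference quotients, so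
  differentiation under the integral sign is dominated convergence along sequences.
\<close>

lemma has_field_derivative_integral:
  fixes f f' :: "'a::{real_normed_field, banach, second_countable_topology} \<Rightarrow> 'b \<Rightarrow> 'a"
  assumes S: "open S" "convex S" and z: "z \<in> S"
    and int: "\<And>w. w \<in> S \<Longrightarrow> integrable M (f w)"
    and meas: "f' z \<in> borel_measurable M"
    and B: "integrable M B"
    and der: "AE \<omega> in M. \<forall>w\<in>S. ((\<lambda>w. f w \<omega>) has_field_derivative f' w \<omega>) (at w) \<and> norm (f' w \<omega>) \<le> B \<omega>"
  shows "((\<lambda>w. \<integral>\<omega>. f w \<omega> \<partial>M) has_field_derivative (\<integral>\<omega>. f' z \<omega> \<partial>M)) (at z)"
proof -
  have "(\<lambda>n. ((\<integral>\<omega>. f (Z n) \<omega> \<partial>M) - (\<integral>\<omega>. f z \<omega> \<partial>M)) / (Z n - z)) \<longlonglongrightarrow> (\<integral>\<omega>. f' z \<omega> \<partial>M)"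
    if Z: "\<And>n. Z n \<in> S - {z}" and lim: "Z \<longlonglongrightarrow> z" for Z
  proof -
    define q where "q n \<omega> = (f (Z n) \<omega> - f z \<omega>) / (Z n - z)" for n \<omega>
    have intq: "integrable M (q n)" for n
      using Z[of n] unfolding q_def by (intro integrable_divide Bochner_Integration.integrable_diff int z) auto
    have "(\<lambda>n. integral\<^sup>L M (q n)) \<longlonglongrightarrow> integral\<^sup>L M (f' z)"
    proof (rule integral_dominated_convergence[where w = B])
      show "AE \<omega> in M. (\<lambda>n. q n \<omega>) \<longlonglongrightarrow> f' z \<omega>"
        using der
      proof eventually_elim
        case (elim \<omega>)
        then have "((\<lambda>w. f w \<omega>) has_field_derivative f' z \<omega>) (at z within S)"
          using z has_field_derivative_at_within by blast
        then have "((\<lambda>w. (f w \<omega> - f z \<omega>) / (w - z)) \<longlongrightarrow> f' z \<omega>) (at z within S)"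
          by (simp add: has_field_derivative_iff)
        then show ?case
          using Z lim unfolding tendsto_at_iff_sequentially comp_def q_def by blast
      qed
      show "AE \<omega> in M. norm (q n \<omega>) \<le> B \<omega>" for n
        using der
      proof eventually_elim
        case (elim \<omega>)
        have "norm (f (Z n) \<omega> - f z \<omega>) \<le> B \<omega> * norm (Z n - z)"
          by (rule field_differentiable_bound[OF S(2), where f' = "\<lambda>w. f' w \<omega>"])
            (use elim Z z in \<open>auto intro: has_field_derivative_at_within\<close>)
        then show ?case
          using Z[of n] by (simp add: q_def norm_divide divide_simps)
      qed
    qed (use meas B intq in auto)
    moreover have "integral\<^sup>L M (q n) = ((\<integral>\<omega>. f (Z n) \<omega> \<partial>M) - (\<integral>\<omega>. f z \<omega> \<partial>M)) / (Z n - z)" for n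
      using Z[of n] z unfolding q_def[abs_def]
      by (simp add: Bochner_Integration.integral_diff[OF int int])
    ultimately show ?thesis
      by simp
  qed
  then have "((\<lambda>w. \<integral>\<omega>. f w \<omega> \<partial>M) has_field_derivative (\<integral>\<omega>. f' z \<omega> \<partial>M)) (at z within S)"
    unfolding has_field_derivative_iff tendsto_at_iff_sequentially comp_def by blast
  then show ?thesis
    unfolding at_within_open[OF z S(1)] .
qed

lemma norm_translate_ge:
  assumes "0 \<le> x" "0 < Re z"
  shows "norm z \<le> norm (complex_of_real x + z)" "Re z \<le> norm (complex_of_real x + z)"
    "complex_of_real x + z \<notin> \<real>\<^sub>\<le>\<^sub>0"
proof -
  show "norm z \<le> norm (complex_of_real x + z)"
    unfolding cmod_def using assms by (auto intro!: power_mono)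
  show "Re z \<le> norm (complex_of_real x + z)"
    using complex_Re_le_cmod[of "complex_of_real x + z"] assms by simp
  show "complex_of_real x + z \<notin> \<real>\<^sub>\<le>\<^sub>0"
    using assms by (auto simp: complex_nonpos_Reals_iff)
qed

lemma translated_powr_has_derivative:
  assumes "0 \<le> x" "0 < Re z"
  shows "((\<lambda>z. (of_real x + z) powr of_real p) has_field_derivative
           of_real p * (of_real x + z) powr of_real (p - 1)) (at z)"
  using norm_translate_ge(3)[OF assms]
  by (auto intro!: derivative_eq_intros has_field_derivative_powr[THEN DERIV_chain2] simp: complex_nonpos_Reals_iff)

lemma norm_translated_powr_le:
  assumes "0 \<le> x" "0 < d" "d \<le> Re z" "p \<le> 0"
  shows "norm ((of_real x + z) powr complex_of_real p) \<le> d powr p"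
proof -
  have "d \<le> norm (complex_of_real x + z)"
    using norm_translate_ge(2)[of x z] assms by simp
  then show ?thesis
    using assms by (simp add: norm_powr_real_powr' powr_mono2')
qed

text \<open>
  This bound, uniform in \<open>z\<close>, is what makes the difference of two translated moments bounded.
  For \<open>x \<le> |z|\<close> the mean value inequality gives \<open>s |z| powr (s - 1) * x\<close>, which is at most
  \<open>s * x powr s\<close> because \<open>s < 1\<close>; for \<open>x > |z|\<close> the two terms are at most \<open>2 * x powr s\<close>
  and \<open>x powr s\<close>.
\<close>

lemma norm_translated_powr_diff_le:
  assumes x: "0 \<le> x" and z: "0 < Re z" and s: "0 < s" "s < 1"
  shows "norm ((of_real x + z) powr of_real s - z powr complex_of_real s) \<le> 3 * x powr s"
proof (cases "x \<le> norm z")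
  case True
  have z0: "0 < norm z"
    using z by auto
  show ?thesis
  proof (cases "x = 0")
    case False
    then have x0: "0 < x" using x by simp
    \<comment> \<open>The mean value inequality in the translation variable, along the half-line of nonnegative reals.\<close>
    have "norm ((of_real x + z) powr of_real s - (of_real 0 + z) powr complex_of_real s)
        \<le> s * norm z powr (s - 1) * norm (of_real x - of_real 0 :: complex)"
    proof (rule field_differentiable_bound[where S = "complex_of_real ` {0..}"
          and f' = "\<lambda>w. of_real s * (w + z) powr of_real (s - 1)"])
      show "convex (complex_of_real ` {0..})"
        by (intro convex_linear_image) (auto intro: bounded_linear.linear bounded_linear_of_real)
      fix w :: complex
      assume "w \<in> complex_of_real ` {0..}"
      then obtain t where t: "0 \<le> t" "w = of_real t"
        by auto
      show "((\<lambda>w. (w + z) powr complex_of_real s) has_field_derivative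
              of_real s * (w + z) powr of_real (s - 1)) (at w within complex_of_real ` {0..})"
        using norm_translate_ge(3)[OF t(1) z] t(2)
        by (auto intro!: derivative_eq_intros has_field_derivative_powr[THEN DERIV_chain2]
            simp: complex_nonpos_Reals_iff)
      show "norm (complex_of_real s * (w + z) powr of_real (s - 1)) \<le> s * norm z powr (s - 1)"
        using norm_translate_ge(1)[OF t(1) z] t(2) s z0
        by (simp add: norm_mult norm_powr_real_powr' powr_mono2' add.commute del: of_real_diff)
    qed (use x in auto)
    also have "\<dots> \<le> s * x powr (s - 1) * x"
      using True x0 s by (simp add: powr_mono2')
    also have "\<dots> = s * x powr s"
      using x0 by (simp add: powr_diff)
    also have "\<dots> \<le> 3 * x powr s"
      using s by (intro mult_right_mono) auto
    finally show ?thesis by simp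
  qed simp
next
  case False
  have "norm (complex_of_real x + z) \<le> 2 * x"
    using norm_triangle_ineq[of "complex_of_real x" z] False x by simp
  then have "norm (complex_of_real x + z) powr s \<le> (2 * x) powr s"
    using s by (intro powr_mono2) auto
  also have "\<dots> \<le> 2 * x powr s"
    using x s powr_mono[of s 1 2] by (auto simp: powr_mult intro: mult_right_mono)
  finally have "norm (complex_of_real x + z) powr s \<le> 2 * x powr s" .
  moreover have "norm z powr s \<le> x powr s"
    using False s by (intro powr_mono2) auto
  ultimately show ?thesis
    using norm_triangle_ineq4[of "(of_real x + z) powr of_real s" "z powr complex_of_real s"]
    by (simp add: norm_powr_real_powr')
qed

definition translated_moment :: "'a measure \<Rightarrow> ('a \<Rightarrow> real) \<Rightarrow> real \<Rightarrow> complex \<Rightarrow> complex" where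
  "translated_moment M X p z = (\<integral>\<omega>. (of_real (X \<omega>) + z) powr of_real p \<partial>M)"

lemma borel_measurable_translated_powr [measurable]:
  assumes [measurable]: "X \<in> borel_measurable M"
  shows "(\<lambda>\<omega>. (complex_of_real (X \<omega>) + z) powr of_real p) \<in> borel_measurable M"
  unfolding powr_def by measurable

text \<open>
  The two alternatives for \<open>p\<close> are those met when an exponent in \<open>(0, 1)\<close> is lowered repeatedly
  by 1: only the initial exponent depends on a moment of \<open>X\<close>, later powers are bounded.
\<close>

lemma integrable_translated_powr:
  assumes "prob_space M" and [measurable]: "X \<in> borel_measurable M" and nonneg: "AE \<omega> in M. 0 \<le> X \<omega>"
    and p: "p \<le> 0 \<or> (0 < p \<and> p < 1 \<and> integrable M (\<lambda>\<omega>. X \<omega> powr p))" and z: "0 < Re z"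
  shows "integrable M (\<lambda>\<omega>. (of_real (X \<omega>) + z) powr complex_of_real p)"
proof -
  interpret prob_space M by fact
  show ?thesis
    using p
  proof (elim disjE conjE)
    assume p: "p \<le> 0"
    show ?thesis
    proof (rule integrable_const_bound)
      show "AE \<omega> in M. norm ((of_real (X \<omega>) + z) powr complex_of_real p) \<le> Re z powr p"
        using nonneg by eventually_elim (use p z in \<open>auto intro: norm_translated_powr_le\<close>)
    qed simp
  next
    assume p: "0 < p" "p < 1" and int: "integrable M (\<lambda>\<omega>. X \<omega> powr p)"
    have "integrable M (\<lambda>\<omega>. (of_real (X \<omega>) + z) powr of_real p - z powr complex_of_real p)"
    proof (rule Bochner_Integration.integrable_bound)
      show "AE \<omega> in M. norm ((of_real (X \<omega>) + z) powr of_real p - z powr complex_of_real p)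
          \<le> norm (3 * X \<omega> powr p)"
        using nonneg by eventually_elim (use norm_translated_powr_diff_le p z in auto)
    qed (use int in auto)
    then have "integrable M (\<lambda>\<omega>. ((of_real (X \<omega>) + z) powr of_real p - z powr complex_of_real p)
        + z powr complex_of_real p)"
      by (intro Bochner_Integration.integrable_add) auto
    then show ?thesis by simp
  qed
qed

text \<open>
  Near the imaginary axis the powers with negative exponent blow up, so domination is only
  available on the smaller half-plane \<open>Re w > d\<close> with \<open>0 < d < Re z\<close>.
\<close>

lemma translated_moment_has_derivative:
  assumes "prob_space M" and [measurable]: "X \<in> borel_measurable M" and nonneg: "AE \<omega> in M. 0 \<le> X \<omega>"
    and p: "p \<le> 0 \<or> (0 < p \<and> p < 1 \<and> integrable M (\<lambda>\<omega>. X \<omega> powr p))" and z: "0 < Re z"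
  shows "(translated_moment M X p has_field_derivative of_real p * translated_moment M X (p - 1) z) (at z)"
proof -
  interpret prob_space M by fact
  define d where "d = Re z / 2"
  have d: "0 < d" "d < Re z" using z by (auto simp: d_def)
  have "((\<lambda>w. \<integral>\<omega>. (of_real (X \<omega>) + w) powr of_real p \<partial>M) has_field_derivative
      (\<integral>\<omega>. of_real p * (of_real (X \<omega>) + z) powr of_real (p - 1) \<partial>M)) (at z)"
  proof (rule has_field_derivative_integral[where S = "{w. d < Re w}" and B = "\<lambda>_. \<bar>p\<bar> * d powr (p - 1)"
        and f' = "\<lambda>w \<omega>. of_real p * (of_real (X \<omega>) + w) powr of_real (p - 1)"])
    show "AE \<omega> in M. \<forall>w\<in>{w. d < Re w}.
        ((\<lambda>w. (of_real (X \<omega>) + w) powr of_real p) has_field_derivative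
          of_real p * (of_real (X \<omega>) + w) powr of_real (p - 1)) (at w) \<and>
        norm (complex_of_real p * (of_real (X \<omega>) + w) powr of_real (p - 1)) \<le> \<bar>p\<bar> * d powr (p - 1)"
      using nonneg
    proof eventually_elim
      case (elim \<omega>)
      show ?case
      proof safe
        fix w assume "d < Re w"
        then show "((\<lambda>w. (of_real (X \<omega>) + w) powr of_real p) has_field_derivative
          of_real p * (of_real (X \<omega>) + w) powr of_real (p - 1)) (at w)"
          using elim d by (intro translated_powr_has_derivative) auto
        show "norm (complex_of_real p * (of_real (X \<omega>) + w) powr of_real (p - 1)) \<le> \<bar>p\<bar> * d powr (p - 1)"
          unfolding norm_mult using norm_translated_powr_le[of "X \<omega>" d w "p - 1"] elim d \<open>d < Re w\<close> p
          by (intro mult_mono) (auto simp del: of_real_diff)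
      qed
    qed
  next
    show "integrable M (\<lambda>\<omega>. (of_real (X \<omega>) + w) powr complex_of_real p)" if "w \<in> {w. d < Re w}" for w
      using that d by (intro integrable_translated_powr assms) auto
  qed (use d in \<open>auto simp: open_halfspace_Re_gt convex_halfspace_Re_gt\<close>)
  then show ?thesis
    by (simp add: translated_moment_def[abs_def])
qed

text \<open>
  The translated moment itself grows like \<open>|z| powr s\<close>, but its leading term does not depend on
  the random variable and cancels between two of them.
\<close>

lemma norm_translated_moment_diff_le:
  assumes "prob_space M" and [measurable]: "X \<in> borel_measurable M" and nonneg: "AE \<omega> in M. 0 \<le> X \<omega>"
    and s: "0 < s" "s < 1" and int: "integrable M (\<lambda>\<omega>. X \<omega> powr s)" and z: "0 < Re z"
  shows "norm (translated_moment M X s z - z powr of_real s) \<le> 3 * (\<integral>\<omega>. X \<omega> powr s \<partial>M)"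
proof -
  interpret prob_space M by fact
  have int': "integrable M (\<lambda>\<omega>. (of_real (X \<omega>) + z) powr complex_of_real s)"
    using assms by (intro integrable_translated_powr) auto
  have "translated_moment M X s z - z powr of_real s
      = (\<integral>\<omega>. (of_real (X \<omega>) + z) powr of_real s - z powr complex_of_real s \<partial>M)"
    using int' by (simp add: translated_moment_def prob_space)
  also have "norm \<dots> \<le> (\<integral>\<omega>. norm ((of_real (X \<omega>) + z) powr of_real s - z powr complex_of_real s) \<partial>M)"
    by (rule integral_norm_bound)
  also have "\<dots> \<le> (\<integral>\<omega>. 3 * X \<omega> powr s \<partial>M)"
  proof (rule integral_mono_AE)
    show "AE \<omega> in M. norm ((of_real (X \<omega>) + z) powr of_real s - z powr complex_of_real s) \<le> 3 * X \<omega> powr s"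
      using nonneg by eventually_elim (use norm_translated_powr_diff_le s z in blast)
  qed (use int' int in auto)
  finally show ?thesis by simp
qed

lemma translated_moment_of_real:
  assumes "AE \<omega> in M. 0 \<le> X \<omega>" "0 < a"
    and [measurable]: "X \<in> borel_measurable M"
  shows "translated_moment M X p (of_real a) = of_real (\<integral>\<omega>. (X \<omega> + a) powr p \<partial>M)"
proof -
  have "translated_moment M X p (of_real a) = (\<integral>\<omega>. complex_of_real ((X \<omega> + a) powr p) \<partial>M)"
    unfolding translated_moment_def
  proof (rule integral_cong_AE)
    show "AE \<omega> in M. (of_real (X \<omega>) + of_real a) powr complex_of_real p = of_real ((X \<omega> + a) powr p)"
      using assms(1) by eventually_elim (use assms(2) in \<open>simp add: powr_of_real flip: of_real_add\<close>)
  qed auto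
  then show ?thesis by simp
qed

text \<open>
  Differentiation in \<open>z\<close> lowers the exponent by 1, and the nonzero factor \<open>p\<close> cancels.
\<close>

lemma translated_moment_pred_eq:
  assumes M: "prob_space M" "X \<in> borel_measurable M" "AE \<omega> in M. 0 \<le> X \<omega>"
      "p \<le> 0 \<or> (0 < p \<and> p < 1 \<and> integrable M (\<lambda>\<omega>. X \<omega> powr p))"
    and N: "prob_space N" "Y \<in> borel_measurable N" "AE \<omega> in N. 0 \<le> Y \<omega>"
      "p \<le> 0 \<or> (0 < p \<and> p < 1 \<and> integrable N (\<lambda>\<omega>. Y \<omega> powr p))"
    and p: "p \<noteq> 0"
    and eq: "\<And>z. 0 < Re z \<Longrightarrow> translated_moment M X p z = translated_moment N Y p z"
    and z: "0 < Re z"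
  shows "translated_moment M X (p - 1) z = translated_moment N Y (p - 1) z"
proof -
  have "(translated_moment N Y p has_field_derivative of_real p * translated_moment M X (p - 1) z) (at z)"
  proof (rule has_field_derivative_transform_within_open[OF translated_moment_has_derivative[OF M z]])
    show "open {z. 0 < Re z}" by (rule open_halfspace_Re_gt)
  qed (use eq z in auto)
  then have "of_real p * translated_moment M X (p - 1) z = of_real p * translated_moment N Y (p - 1) z"
    using translated_moment_has_derivative[OF N z] DERIV_unique by blast
  then show ?thesis
    using p by simp
qed

section \<open>From translated moments to the distribution function\<close>

text \<open>
  A continuous step from 1 at \<open>x\<close> to 0 at \<open>y\<close> has expectation between the distribution function
  at \<open>x\<close> and at \<open>y\<close>. If these expectations agree, each distribution function at \<open>x\<close> is below
  the other one at any \<open>y > x\<close>, and right continuity closes the gap.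
\<close>

lemma cdf_distr_eqI:
  assumes M: "prob_space M" "X \<in> borel_measurable M" and N: "prob_space N" "Y \<in> borel_measurable N"
    and eq: "\<And>x y. x < y \<Longrightarrow> (\<integral>\<omega>. cts_step x y (X \<omega>) \<partial>M) = (\<integral>\<omega>. cts_step x y (Y \<omega>) \<partial>N)"
  shows "cdf (distr M borel X) = cdf (distr N borel Y)"
proof -
  have le: "cdf \<mu> x \<le> cdf \<nu> x"
    if \<mu>: "real_distribution \<mu>" and \<nu>: "real_distribution \<nu>"
      and eq: "\<And>x y. x < y \<Longrightarrow> integral\<^sup>L \<mu> (cts_step x y) = integral\<^sup>L \<nu> (cts_step x y)" for \<mu> \<nu> x
  proof -
    interpret \<nu>: real_distribution \<nu> by fact
    have "(cdf \<nu> \<longlongrightarrow> cdf \<nu> x) (at_right x)"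
      using \<nu>.cdf_is_right_cont[of x] by (simp add: continuous_within)
    moreover have "\<forall>\<^sub>F y in at_right x. cdf \<mu> x \<le> cdf \<nu> y"
      using eventually_at_right_less
    proof eventually_elim
      case (elim y)
      then show ?case
        using real_distribution.cdf_cts_step[OF \<mu> elim] real_distribution.cdf_cts_step[OF \<nu> elim] eq[OF elim]
        by linarith
    qed
    ultimately show ?thesis
      by (rule tendsto_lowerbound) simp
  qed
  have meas[measurable]: "cts_step x y \<in> borel_measurable borel" for x y
    unfolding cts_step_def[abs_def] by measurable
  have rd: "real_distribution (distr M borel X)" "real_distribution (distr N borel Y)"
    using M N by (auto intro: prob_space.real_distribution_distr)
  have "integral\<^sup>L (distr M borel X) (cts_step x y) = integral\<^sup>L (distr N borel Y) (cts_step x y)"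
    if "x < y" for x y
    using eq[OF that] M N by (simp add: integral_distr)
  then show ?thesis
    using le[OF rd(1,2)] le[OF rd(2,1)] by (intro ext antisym) auto
qed

lemma integrable_mult_continuous:
  fixes v W :: "'a \<Rightarrow> real" and g :: "real \<Rightarrow> real"
  assumes v: "integrable Q v" and [measurable]: "W \<in> borel_measurable Q"
    and W: "AE \<omega> in Q. W \<omega> \<in> {0..1}" and g: "continuous_on UNIV g"
  shows "integrable Q (\<lambda>\<omega>. v \<omega> * g (W \<omega>))"
proof -
  have [measurable]: "g \<in> borel_measurable borel"
    using g by (rule borel_measurable_continuous_onI)
  have "bounded (g ` {0..1})"
    using g by (intro compact_imp_bounded compact_continuous_image) (auto intro: continuous_on_subset)
  then obtain K where K: "\<forall>x\<in>{0..1}. \<bar>g x\<bar> \<le> K"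
    by (auto simp: bounded_iff)
  show ?thesis
  proof (rule Bochner_Integration.integrable_bound[where f = "\<lambda>\<omega>. K * v \<omega>"])
    show "AE \<omega> in Q. norm (v \<omega> * g (W \<omega>)) \<le> norm (K * v \<omega>)"
      using W
    proof eventually_elim
      case (elim \<omega>)
      have "\<bar>g (W \<omega>)\<bar> \<le> \<bar>K\<bar>"
        using K elim by fastforce
      then show ?case
        by (simp add: abs_mult mult.commute[of "\<bar>K\<bar>"] mult_left_mono)
    qed
  qed (use v in auto)
qed

lemma integral_mult_continuous_diff_le:
  fixes v W :: "'a \<Rightarrow> real" and g h :: "real \<Rightarrow> real"
  assumes v: "integrable Q v" and W_meas: "W \<in> borel_measurable Q"
    and W: "AE \<omega> in Q. W \<omega> \<in> {0..1}" and h: "continuous_on UNIV h" and g: "continuous_on UNIV g"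
    and e: "\<And>x. x \<in> {0..1} \<Longrightarrow> \<bar>h x - g x\<bar> \<le> e"
  shows "\<bar>(\<integral>\<omega>. v \<omega> * h (W \<omega>) \<partial>Q) - (\<integral>\<omega>. v \<omega> * g (W \<omega>) \<partial>Q)\<bar> \<le> e * (\<integral>\<omega>. \<bar>v \<omega>\<bar> \<partial>Q)"
proof -
  note ih = integrable_mult_continuous[OF v W_meas W h] and ig = integrable_mult_continuous[OF v W_meas W g]
  have "\<bar>(\<integral>\<omega>. v \<omega> * h (W \<omega>) \<partial>Q) - (\<integral>\<omega>. v \<omega> * g (W \<omega>) \<partial>Q)\<bar>
      = norm (\<integral>\<omega>. v \<omega> * h (W \<omega>) - v \<omega> * g (W \<omega>) \<partial>Q)"
    by (simp add: Bochner_Integration.integral_diff[OF ih ig])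
  also have "\<dots> \<le> (\<integral>\<omega>. norm (v \<omega> * h (W \<omega>) - v \<omega> * g (W \<omega>)) \<partial>Q)"
    by (rule integral_norm_bound)
  also have "\<dots> \<le> (\<integral>\<omega>. e * \<bar>v \<omega>\<bar> \<partial>Q)"
  proof (rule integral_mono_AE)
    show "AE \<omega> in Q. norm (v \<omega> * h (W \<omega>) - v \<omega> * g (W \<omega>)) \<le> e * \<bar>v \<omega>\<bar>"
      using W
    proof eventually_elim
      case (elim \<omega>)
      have "norm (v \<omega> * h (W \<omega>) - v \<omega> * g (W \<omega>)) = \<bar>h (W \<omega>) - g (W \<omega>)\<bar> * \<bar>v \<omega>\<bar>"
        by (simp add: abs_mult mult.commute flip: right_diff_distrib)
      then show ?case
        using e[OF elim] by (simp add: mult_right_mono)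
    qed
  qed (use ih ig v in auto)
  finally show ?thesis by simp
qed

lemma integral_mult_polynomial:
  fixes v W :: "'a \<Rightarrow> real"
  assumes "integrable Q v" "W \<in> borel_measurable Q" "AE \<omega> in Q. W \<omega> \<in> {0..1}"
  shows "(\<integral>\<omega>. v \<omega> * (\<Sum>i\<le>n. c i * W \<omega> ^ i) \<partial>Q) = (\<Sum>i\<le>n. c i * (\<integral>\<omega>. v \<omega> * W \<omega> ^ i \<partial>Q))"
proof -
  have "integrable Q (\<lambda>\<omega>. v \<omega> * W \<omega> ^ i)" for i
    by (rule integrable_mult_continuous[OF assms]) (intro continuous_intros)
  then have "(\<integral>\<omega>. (\<Sum>i\<le>n. c i * (v \<omega> * W \<omega> ^ i)) \<partial>Q) = (\<Sum>i\<le>n. c i * (\<integral>\<omega>. v \<omega> * W \<omega> ^ i \<partial>Q))"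
    by simp
  then show ?thesis
    by (simp add: sum_distrib_left mult_ac)
qed

text \<open>
  Hausdorff determinacy for weighted moments on \<open>{0..1}\<close>: by the Weierstrass theorem \<open>h\<close> is a
  uniform limit of polynomials, whose integrals are given by the moments. The error
  of the approximation is controlled by the integrals of the absolute weights.
\<close>

lemma weighted_moments_determine_integrals:
  fixes u V :: "'a \<Rightarrow> real" and u' V' :: "'b \<Rightarrow> real"
  assumes M: "integrable M u" "V \<in> borel_measurable M" "AE \<omega> in M. V \<omega> \<in> {0..1}"
    and N: "integrable N u'" "V' \<in> borel_measurable N" "AE \<omega> in N. V' \<omega> \<in> {0..1}"
    and eq: "\<And>m. (\<integral>\<omega>. u \<omega> * V \<omega> ^ m \<partial>M) = (\<integral>\<omega>. u' \<omega> * V' \<omega> ^ m \<partial>N)"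
    and h: "continuous_on UNIV h"
  shows "(\<integral>\<omega>. u \<omega> * h (V \<omega>) \<partial>M) = (\<integral>\<omega>. u' \<omega> * h (V' \<omega>) \<partial>N)"
proof -
  define D where "D = (\<integral>\<omega>. \<bar>u \<omega>\<bar> \<partial>M) + (\<integral>\<omega>. \<bar>u' \<omega>\<bar> \<partial>N)"
  have D: "0 \<le> D"
    unfolding D_def by (intro add_nonneg_nonneg integral_nonneg_AE) auto
  have close: "\<bar>(\<integral>\<omega>. u \<omega> * h (V \<omega>) \<partial>M) - (\<integral>\<omega>. u' \<omega> * h (V' \<omega>) \<partial>N)\<bar> \<le> 0 + e" if e: "0 < e" for e
  proof -
    \<comment> \<open>\<open>D\<close> may be 0, hence \<open>D + 1\<close> in the denominator.\<close>
    have e': "0 < e / (D + 1)" using e D by simp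
    have "compact {0..1::real}" "continuous_on {0..1} h"
      using h by (auto intro: continuous_on_subset)
    then obtain g where g: "real_polynomial_function g" "\<And>x. x \<in> {0..1} \<Longrightarrow> \<bar>h x - g x\<bar> < e / (D + 1)"
      using Stone_Weierstrass_real_polynomial_function[of "{0..1}" h "e / (D + 1)"] e' by metis
    obtain c n where gsum: "g = (\<lambda>x. \<Sum>i\<le>n. c i * x ^ i)"
      using g(1) real_polynomial_function_iff_sum by auto
    have gc: "continuous_on UNIV g"
      unfolding gsum by (intro continuous_intros)
    have le: "\<And>x. x \<in> {0..1} \<Longrightarrow> \<bar>h x - g x\<bar> \<le> e / (D + 1)"
      using g(2) less_imp_le by blast
    have "(\<integral>\<omega>. u \<omega> * g (V \<omega>) \<partial>M) = (\<integral>\<omega>. u' \<omega> * g (V' \<omega>) \<partial>N)"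
      unfolding gsum by (simp add: integral_mult_polynomial[OF M] integral_mult_polynomial[OF N] eq)
    then have "\<bar>(\<integral>\<omega>. u \<omega> * h (V \<omega>) \<partial>M) - (\<integral>\<omega>. u' \<omega> * h (V' \<omega>) \<partial>N)\<bar> \<le> e / (D + 1) * D"
      using integral_mult_continuous_diff_le[OF M h gc le] integral_mult_continuous_diff_le[OF N h gc le]
      unfolding D_def distrib_left by linarith
    also have "\<dots> \<le> e"
      using e D by (simp add: divide_simps)
    finally show ?thesis by simp
  qed
  then show ?thesis
    using field_le_epsilon[OF close] by simp
qed

lemma inverse_translate_powr:
  fixes x s :: real
  assumes "0 \<le> x"
  shows "(1 / (1 + x)) powr (1 - s) * (1 / (1 + x)) ^ m = (x + 1) powr (s - real (Suc m))"
proof -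
  have 1: "(1 / (1 + x)) powr (1 - s) = (x + 1) powr (s - 1)"
    using assms powr_minus_divide[of "x + 1" "1 - s"] by (simp add: powr_divide add.commute)
  have 2: "(1 / (1 + x)) ^ m = (x + 1) powr (- real m)"
    using assms by (simp add: powr_minus_divide powr_realpow power_divide add.commute)
  show ?thesis
    unfolding 1 2 powr_add[symmetric] by (simp add: algebra_simps)
qed

text \<open>
  In the variable \<open>v = 1 / (1 + t)\<close> a step function of \<open>t\<close>, divided by the weight
  \<open>v powr (1 - s)\<close>, has to be continuous up to \<open>v = 0\<close>, where \<open>t\<close> is infinite and the weight
  vanishes. Replacing \<open>v\<close> by its maximum with \<open>1 / (2 + |y|)\<close> achieves this: below that
  threshold \<open>t > y\<close>, so the step is already 0 there.
\<close>

definition rescaled_cts_step :: "real \<Rightarrow> real \<Rightarrow> real \<Rightarrow> real \<Rightarrow> real" where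
  "rescaled_cts_step s x y v =
     (let w = max v (1 / (2 + \<bar>y\<bar>)) in cts_step x y (1 / w - 1) * w powr (s - 1))"

lemma continuous_on_rescaled_cts_step:
  assumes "x < y"
  shows "continuous_on UNIV (rescaled_cts_step s x y)"
proof -
  have w: "0 < max v (1 / (2 + \<bar>y\<bar>))" for v
    by (simp add: less_max_iff_disj add_pos_nonneg)
  have c: "continuous_on UNIV (cts_step x y)"
    using assms by (intro uniformly_continuous_imp_continuous cts_step_uniformly_continuous)
  show ?thesis
    unfolding rescaled_cts_step_def Let_def using w
    by (intro continuous_intros continuous_on_compose2[OF c]) (auto simp: less_le)
qed

lemma cts_step_eq_rescaled:
  assumes t: "0 \<le> t" and xy: "x < y"
  shows "(1 / (1 + t)) powr (1 - s) * rescaled_cts_step s x y (1 / (1 + t)) = cts_step x y t"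
proof (cases "1 / (2 + \<bar>y\<bar>) \<le> 1 / (1 + t)")
  case True
  then have "max (1 / (1 + t)) (1 / (2 + \<bar>y\<bar>)) = 1 / (1 + t)"
    by simp
  moreover have "(1 / (1 + t)) powr (1 - s) * (1 / (1 + t)) powr (s - 1) = 1"
    using t by (simp flip: powr_add)
  ultimately show ?thesis
    by (simp add: rescaled_cts_step_def Let_def mult.left_commute[of _ "cts_step _ _ _"])
next
  case False
  then have m: "max (1 / (1 + t)) (1 / (2 + \<bar>y\<bar>)) = 1 / (2 + \<bar>y\<bar>)"
    by simp
  have "y < t"
    using False t frac_le[of 1 1 "1 + t" "2 + \<bar>y\<bar>"] by fastforce
  then have "cts_step x y t = 0"
    using xy by (simp add: cts_step_def)
  moreover have "cts_step x y (1 / (1 / (2 + \<bar>y\<bar>)) - 1) = 0"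
    using xy by (auto simp: cts_step_def)
  ultimately show ?thesis
    by (simp add: rescaled_cts_step_def Let_def m)
qed

text \<open>
  Lowering the exponent repeatedly gives equality of the expectations of
  \<open>(X + 1) powr (s - 1 - m)\<close> and \<open>(Y + 1) powr (s - 1 - m)\<close> for every natural number \<open>m\<close>. With
  \<open>V = 1 / (1 + X)\<close> these powers are \<open>V powr (1 - s) * V ^ m\<close>, that is, weighted moments of a
  variable with values in \<open>{0..1}\<close>, which determine the expectations of all continuous steps.
\<close>

lemma translated_moments_determine_cdf:
  assumes M: "prob_space M" "X \<in> borel_measurable M" "AE \<omega> in M. 0 \<le> X \<omega>"
    and N: "prob_space N" "Y \<in> borel_measurable N" "AE \<omega> in N. 0 \<le> Y \<omega>"
    and s: "0 < s" "s < 1"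
    and intX: "integrable M (\<lambda>\<omega>. X \<omega> powr s)" and intY: "integrable N (\<lambda>\<omega>. Y \<omega> powr s)"
    and eq: "\<And>z. 0 < Re z \<Longrightarrow> translated_moment M X s z = translated_moment N Y s z"
  shows "cdf (distr M borel X) = cdf (distr N borel Y)"
proof (rule cdf_distr_eqI[OF M(1,2) N(1,2)])
  interpret M: prob_space M by fact
  interpret N: prob_space N by fact
  note [measurable] = M(2) N(2)
  have eq_n: "translated_moment M X (s - real n) z = translated_moment N Y (s - real n) z"
    if "0 < Re z" for n z
    using that
  proof (induction n arbitrary: z)
    case 0
    then show ?case using eq by simp
  next
    case (Suc n)
    have "s - real n \<le> 0 \<or> n = 0" "s - real n \<noteq> 0"
      using s by (cases n; auto)+
    then have "translated_moment M X (s - real n - 1) z = translated_moment N Y (s - real n - 1) z"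
      using s intX intY Suc by (intro translated_moment_pred_eq M N) auto
    then show ?case
      by (simp add: algebra_simps)
  qed
  define u where "u t = (1 / (1 + t)) powr (1 - s)" for t :: real
  have [measurable]: "u \<in> borel_measurable borel"
    unfolding u_def by measurable
  have moment: "(\<integral>\<omega>. u (Z \<omega>) * (1 / (1 + Z \<omega>)) ^ m \<partial>Q) = Re (translated_moment Q Z (s - real (Suc m)) 1)"
    if "AE \<omega> in Q. 0 \<le> Z \<omega>" and [measurable]: "Z \<in> borel_measurable Q" for Q :: "'c measure" and Z m
  proof -
    have "translated_moment Q Z (s - real (Suc m)) 1 = of_real (\<integral>\<omega>. (Z \<omega> + 1) powr (s - real (Suc m)) \<partial>Q)"
      using translated_moment_of_real[OF that(1), of 1] by simp
    moreover have "(\<integral>\<omega>. u (Z \<omega>) * (1 / (1 + Z \<omega>)) ^ m \<partial>Q) = (\<integral>\<omega>. (Z \<omega> + 1) powr (s - real (Suc m)) \<partial>Q)"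
    proof (rule integral_cong_AE)
      show "AE \<omega> in Q. u (Z \<omega>) * (1 / (1 + Z \<omega>)) ^ m = (Z \<omega> + 1) powr (s - real (Suc m))"
        using that(1) by eventually_elim (unfold u_def, rule inverse_translate_powr)
    qed auto
    ultimately show ?thesis by simp
  qed
  have u1: "norm (u t) \<le> 1" if "0 \<le> t" for t
    unfolding u_def using that s by (auto simp: powr_le1)
  fix x y :: real
  assume xy: "x < y"
  have step: "(\<integral>\<omega>. u (Z \<omega>) * rescaled_cts_step s x y (1 / (1 + Z \<omega>)) \<partial>Q) = (\<integral>\<omega>. cts_step x y (Z \<omega>) \<partial>Q)"
    if "AE \<omega> in Q. 0 \<le> Z \<omega>" and [measurable]: "Z \<in> borel_measurable Q" for Q :: "'c measure" and Z
  proof (rule integral_cong_AE)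
    have [measurable]: "rescaled_cts_step s x y \<in> borel_measurable borel"
      by (intro borel_measurable_continuous_onI continuous_on_rescaled_cts_step xy)
    have [measurable]: "cts_step x y \<in> borel_measurable borel"
      by (intro borel_measurable_continuous_onI uniformly_continuous_imp_continuous
          cts_step_uniformly_continuous xy)
    show "(\<lambda>\<omega>. u (Z \<omega>) * rescaled_cts_step s x y (1 / (1 + Z \<omega>))) \<in> borel_measurable Q"
      "(\<lambda>\<omega>. cts_step x y (Z \<omega>)) \<in> borel_measurable Q"
      by measurable
    show "AE \<omega> in Q. u (Z \<omega>) * rescaled_cts_step s x y (1 / (1 + Z \<omega>)) = cts_step x y (Z \<omega>)"
      using that(1) by eventually_elim (use cts_step_eq_rescaled xy in \<open>auto simp: u_def\<close>)
  qed
  have "(\<integral>\<omega>. u (X \<omega>) * rescaled_cts_step s x y (1 / (1 + X \<omega>)) \<partial>M)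
      = (\<integral>\<omega>. u (Y \<omega>) * rescaled_cts_step s x y (1 / (1 + Y \<omega>)) \<partial>N)"
  proof (rule weighted_moments_determine_integrals[where V = "\<lambda>\<omega>. 1 / (1 + X \<omega>)" and V' = "\<lambda>\<omega>. 1 / (1 + Y \<omega>)"
        and u = "\<lambda>\<omega>. u (X \<omega>)" and u' = "\<lambda>\<omega>. u (Y \<omega>)"])
    show "integrable M (\<lambda>\<omega>. u (X \<omega>))"
      by (rule M.integrable_const_bound[where B = 1]) (use M(3) u1 in \<open>auto elim: eventually_mono\<close>)
    show "integrable N (\<lambda>\<omega>. u (Y \<omega>))"
      by (rule N.integrable_const_bound[where B = 1]) (use N(3) u1 in \<open>auto elim: eventually_mono\<close>)
    show "AE \<omega> in M. 1 / (1 + X \<omega>) \<in> {0..1}"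
      using M(3) by eventually_elim auto
    show "AE \<omega> in N. 1 / (1 + Y \<omega>) \<in> {0..1}"
      using N(3) by eventually_elim auto
    show "(\<integral>\<omega>. u (X \<omega>) * (1 / (1 + X \<omega>)) ^ m \<partial>M) = (\<integral>\<omega>. u (Y \<omega>) * (1 / (1 + Y \<omega>)) ^ m \<partial>N)" for m
      unfolding moment[OF M(3,2)] moment[OF N(3,2)] by (subst eq_n) auto
  qed (use xy in \<open>auto intro: continuous_on_rescaled_cts_step\<close>)
  then show "(\<integral>\<omega>. cts_step x y (X \<omega>) \<partial>M) = (\<integral>\<omega>. cts_step x y (Y \<omega>) \<partial>N)"
    unfolding step[OF M(3,2)] step[OF N(3,2)] .
qed

section \<open>Determinacy by translated fractional moments\<close>

theorem theorem7:
  fixes M :: "'a measure" and X :: "'a \<Rightarrow> real"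
    and N :: "'b measure" and Y :: "'b \<Rightarrow> real"
    and s :: real and a :: "nat \<Rightarrow> real"
  assumes "prob_space M" and "X \<in> borel_measurable M" and "AE \<omega> in M. 0 \<le> X \<omega>"
    and "0 < s" and "s < 1"
    and "integrable M (\<lambda>\<omega>. X \<omega> powr s)"
    and "0 < prob_space.expectation M (\<lambda>\<omega>. X \<omega> powr s)"
    and "\<And>k. 1 \<le> k \<Longrightarrow> 0 < a k"
    and "inj_on a {1..}"
    and "(filterlim a at_top sequentially \<and>
            filterlim (\<lambda>n. \<Sum>k = 1..n. 1 / a k) at_top sequentially) \<or>
         (\<exists>a0 > 0. a \<longlonglongrightarrow> a0) \<or>
         (a \<longlonglongrightarrow> 0 \<and>
            filterlim (\<lambda>n. \<Sum>k = 1..n. a k) at_top sequentially)"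
    and "prob_space N" and "Y \<in> borel_measurable N" and "AE \<omega> in N. 0 \<le> Y \<omega>"
    and "prob_space.expectation N (\<lambda>\<omega>. Y \<omega> powr s) =
         prob_space.expectation M (\<lambda>\<omega>. X \<omega> powr s)"
    and "\<And>k. 1 \<le> k \<Longrightarrow>
         prob_space.expectation N (\<lambda>\<omega>. (Y \<omega> + a k) powr s) =
         prob_space.expectation M (\<lambda>\<omega>. (X \<omega> + a k) powr s)"
  shows "cdf (distr N borel Y) = cdf (distr M borel X)"
proof -
  note M = assms(1-3) and N = assms(11-13) and s = assms(4,5) and intX = assms(6) and pos = assms(8)
  \<comment> \<open>A function that is not integrable has integral 0, but here the integral is positive.\<close>
  have intY: "integrable N (\<lambda>\<omega>. Y \<omega> powr s)"
    using assms(7,14) not_integrable_integral_eq[of N "\<lambda>\<omega>. Y \<omega> powr s"] by auto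
  define \<phi> where "\<phi> z = translated_moment N Y s z - translated_moment M X s z" for z
  define C where "C = 3 * (\<integral>\<omega>. Y \<omega> powr s \<partial>N) + 3 * (\<integral>\<omega>. X \<omega> powr s \<partial>M)"
  have hol: "\<phi> holomorphic_on {z. 0 < Re z}"
  proof (rule holomorphic_onI)
    fix z :: complex
    assume "z \<in> {z. 0 < Re z}"
    then have "(\<phi> has_field_derivative of_real s * translated_moment N Y (s - 1) z
                 - of_real s * translated_moment M X (s - 1) z) (at z)"
      unfolding \<phi>_def
      by (intro DERIV_diff translated_moment_has_derivative M N) (use s intX intY in auto)
    then show "\<phi> field_differentiable at z within {z. 0 < Re z}"
      using field_differentiable_at_within field_differentiable_def by blast
  qed
  have bound: "norm (\<phi> z) \<le> C" if "0 < Re z" for z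
  proof -
    have "\<phi> z = (translated_moment N Y s z - z powr of_real s) - (translated_moment M X s z - z powr of_real s)"
      by (simp add: \<phi>_def)
    also have "norm \<dots> \<le> norm (translated_moment N Y s z - z powr of_real s)
                         + norm (translated_moment M X s z - z powr of_real s)"
      by (rule norm_triangle_ineq4)
    also have "\<dots> \<le> C"
      unfolding C_def
      by (intro add_mono norm_translated_moment_diff_le M N s intX intY that)
    finally show ?thesis .
  qed
  have zero: "\<phi> (of_real (a k)) = 0" if "1 \<le> k" for k
    unfolding \<phi>_def translated_moment_of_real[OF M(3) pos[OF that] M(2)]
      translated_moment_of_real[OF N(3) pos[OF that] N(2)]
    using assms(15)[OF that] by simp
  have "\<phi> z = 0" if "0 < Re z" for z
    by (rule bounded_holomorphic_halfplane_eq_0[OF hol bound pos zero assms(9)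
          Blaschke_sum_diverges[OF pos assms(10)] that])
  then have "translated_moment N Y s z = translated_moment M X s z" if "0 < Re z" for z
    using that by (simp add: \<phi>_def)
  then show ?thesis
    by (rule translated_moments_determine_cdf[OF N M s intY intX])
qed

end
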